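(* Let $\alpha\in(0,1)$ and $\rho\in[0,1]$. For each $n\ge 1$ let $c_n\in\mathbb{R}$ be defined by $\Phi(-c_n)=\alpha/n$, and let $$\mathrm{FWER}_n(\rho)=P\big(X_i> c_n \text{ for some } i\in\{1,\dots,n\}\big),$$ where $(X_1,\dots,X_n)$ is jointly normal with $X_i\sim N(0,1)$ for all $i$ and $\mathrm{Corr}(X_i,X_j)=\rho$ for all $i\ne j$. Then the family wise error rate of Bonferroni's procedure is asymptotically bounded by $\alpha(1-\rho)$: $$\limsup_{n\to\infty}\mathrm{FWER}_n(\rho)\ \le\ \alpha(1-\rho).$$
   Context: $\Phi$ is the cumulative distribution function of $N(0,1)$. Setting: the null hypotheses are $H_{0i}:X_i\sim N(0,1)$, $i=1,\dots,n$. Bonferroni's procedure at level $\alpha$ tests each $H_{0i}$ at size $\alpha/n$, rejecting it when $X_i>c_n$. $\mathrm{FWER}_n(\rho)$ is the probability of at least one false rejection, computed under the intersection of all null hypotheses. *)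

theory Defs
  imports "HOL-Probability.Probability"
begin

definition std_normal_cdf :: "real \<Rightarrow> real"  (\<open>\<Phi>\<close>)
  where "\<Phi> = cdf std_normal_distribution"

definition covariance :: "'a measure \<Rightarrow> ('a \<Rightarrow> real) \<Rightarrow> ('a \<Rightarrow> real) \<Rightarrow> real" where
  "covariance M X Y =
     (\<integral>\<omega>. (X \<omega> - (\<integral>\<omega>'. X \<omega>' \<partial>M)) * (Y \<omega> - (\<integral>\<omega>'. Y \<omega>' \<partial>M)) \<partial>M)"

definition correlation :: "'a measure \<Rightarrow> ('a \<Rightarrow> real) \<Rightarrow> ('a \<Rightarrow> real) \<Rightarrow> real" where
  "correlation M X Y =
     covariance M X Y / (sqrt (covariance M X X) * sqrt (covariance M Y Y))"

(* The first disjunct is the point mass N(\<mu>, 0). *)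
definition normal_rv :: "'a measure \<Rightarrow> ('a \<Rightarrow> real) \<Rightarrow> bool" where
  "normal_rv M Y \<longleftrightarrow>
     (\<exists>\<mu>. Y \<in> borel_measurable M \<and> (AE \<omega> in M. Y \<omega> = \<mu>)) \<or>
     (\<exists>\<mu> \<sigma>. \<sigma> > 0 \<and> distributed M lborel Y (normal_density \<mu> \<sigma>))"

(* Joint normality via linear combinations. A joint density would be too restrictive:
   for correlation 1 the covariance matrix is singular. *)
definition jointly_normal :: "'a measure \<Rightarrow> 'i set \<Rightarrow> ('i \<Rightarrow> 'a \<Rightarrow> real) \<Rightarrow> bool" where
  "jointly_normal M I X \<longleftrightarrow>
     (\<forall>a :: 'i \<Rightarrow> real. normal_rv M (\<lambda>\<omega>. \<Sum>i\<in>I. a i * X i \<omega>))"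

(* M is meant to satisfy all n null hypotheses, so that every rejection X i > c is false. *)
definition FWER :: "'a measure \<Rightarrow> nat \<Rightarrow> (nat \<Rightarrow> 'a \<Rightarrow> real) \<Rightarrow> real \<Rightarrow> real" where
  "FWER M n X c = measure M {\<omega> \<in> space M. \<exists>i\<in>{1..n}. X i \<omega> > c}"

end

theory Submission
  imports Defs "HOL-Real_Asymp.Real_Asymp"
begin

text \<open>
  If \<open>\<rho> = 0\<close>, the claim is the union bound: \<open>n\<close> events of probability \<open>\<alpha> / n\<close> each.

  If \<open>\<rho> > 0\<close>, the error rate even tends to \<open>0\<close>, for every fixed \<open>\<alpha>\<close>. The reason is that a fixed
  part of the variance of each \<open>X\<^sub>i\<close> is shared by all coordinates, so it does not help the maximum
  to grow with \<open>n\<close>. The sample mean \<open>A = (X\<^sub>1 + \<dots> + X\<^sub>n) / n\<close> stands for the shared part.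
  By lemma \<open>equicorrelated_second_moment\<close>, \<open>A\<close> has variance at most \<open>1\<close> and each residual
  \<open>X\<^sub>i - A\<close> has variance at most \<open>1 - \<rho>\<close>; all of them are normal by joint normality. If some
  \<open>X\<^sub>i > c\<close>, then \<open>A > \<delta> c\<close> or some residual exceeds \<open>(1 - \<delta>) c\<close>. With \<open>\<delta> = \<rho> / 4\<close>, the
  residual threshold is at least \<open>\<kappa> c\<close> standard deviations for a constant \<open>\<kappa> > 1\<close>, so the error
  rate is at most \<open>\<Phi> (- \<delta> c\<^sub>n) + n \<Phi> (- \<kappa> c\<^sub>n)\<close> (lemma \<open>FWER_mean_residual_bound\<close>).
  Since \<open>c\<^sub>n\<close> tends to infinity, the first term vanishes. The second equals
  \<open>\<alpha> \<Phi> (- \<kappa> c\<^sub>n) / \<Phi> (- c\<^sub>n)\<close>, and by lemma \<open>std_normal_cdf_scale_le\<close> this quotient decays like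
  \<open>exp (- (\<kappa>\<^sup>2 - 1) c\<^sub>n\<^sup>2 / 2)\<close>.
  Only union bounds are used, so no independent representation of the \<open>X\<^sub>i\<close> is required; residuals
  that degenerate to constants, as for \<open>\<rho> = 1\<close>, are covered by lemma \<open>centred_normal_tail_le\<close>.
\<close>

section \<open>Tails of the normal distribution\<close>

interpretation std_normal: real_distribution std_normal_distribution
  by (rule real_dist_normal_dist)

lemma std_normal_cdf_mono: "x \<le> y \<Longrightarrow> \<Phi> x \<le> \<Phi> y"
  unfolding std_normal_cdf_def by (rule std_normal.cdf_nondecreasing)

lemma std_normal_cdf_nonneg: "0 \<le> \<Phi> x"
  unfolding std_normal_cdf_def by (rule std_normal.cdf_nonneg)

lemma std_normal_cdf_at_bot: "(\<Phi> \<longlongrightarrow> 0) at_bot"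
  unfolding std_normal_cdf_def by (rule std_normal.cdf_lim_at_bot)

lemma ennreal_std_normal_cdf:
  "ennreal (\<Phi> x) = (\<integral>\<^sup>+y. ennreal (std_normal_density y) * indicator {..x} y \<partial>lborel)"
proof -
  have "ennreal (\<Phi> x) = emeasure std_normal_distribution {..x}"
    by (simp add: std_normal_cdf_def cdf_def2 std_normal.emeasure_eq_measure)
  then show ?thesis
    by (simp add: emeasure_density)
qed

lemma std_normal_cdf_pos: "0 < \<Phi> x"
proof (rule ccontr)
  assume "\<not> 0 < \<Phi> x"
  then have "(\<integral>\<^sup>+y. ennreal (std_normal_density y) * indicator {..x} y \<partial>lborel) = 0"
    using std_normal_cdf_nonneg[of x] by (simp flip: ennreal_std_normal_cdf)
  then have "AE y in lborel. ennreal (std_normal_density y) * indicator {..x} y = 0"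
    by (subst (asm) nn_integral_0_iff_AE) auto
  then have "AE y in lborel. y \<notin> {..x}"
    by eventually_elim
      (use normal_density_pos[of 1 0] in \<open>auto simp: indicator_def ennreal_eq_0_iff not_le[symmetric]
         split: if_splits\<close>)
  then have "emeasure lborel {..x} = 0"
    by (subst (asm) AE_iff_measurable[of "{..x}"]) auto
  moreover have "emeasure lborel {x - 1..x} \<le> emeasure lborel {..x}"
    by (rule emeasure_mono) auto
  ultimately show False by simp
qed

text \<open>
  After the substitution \<open>y = \<kappa> z\<close> both sides are integrals over the same half-line, and the
  quotient of the integrands is \<open>\<kappa> exp (- (\<kappa>\<^sup>2 - 1) z\<^sup>2 / 2)\<close>, which is largest at its end point.
\<close>
lemma std_normal_cdf_scale_le:
  assumes "\<kappa> \<ge> 1" "x \<ge> 0"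
  shows "\<Phi> (- (\<kappa> * x)) \<le> \<kappa> * exp (- (\<kappa>\<^sup>2 - 1) * x\<^sup>2 / 2) * \<Phi> (- x)"
proof -
  define C where "C = \<kappa> * exp (- (\<kappa>\<^sup>2 - 1) * x\<^sup>2 / 2)"
  have [simp]: "C \<ge> 0"
    using assms by (simp add: C_def)
  have le: "\<kappa> * std_normal_density (\<kappa> * z) \<le> C * std_normal_density z" if "z \<le> - x" for z
  proof -
    have "x\<^sup>2 \<le> z\<^sup>2"
      using that assms by (simp add: abs_le_square_iff[symmetric])
    then have "(\<kappa>\<^sup>2 - 1) * x\<^sup>2 \<le> (\<kappa>\<^sup>2 - 1) * z\<^sup>2"
      using assms by (intro mult_left_mono) auto
    then have "- (\<kappa> * z)\<^sup>2 / 2 \<le> - (\<kappa>\<^sup>2 - 1) * x\<^sup>2 / 2 + - z\<^sup>2 / 2"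
      by (simp add: power_mult_distrib algebra_simps)
    then have "exp (- (\<kappa> * z)\<^sup>2 / 2) \<le> exp (- (\<kappa>\<^sup>2 - 1) * x\<^sup>2 / 2) * exp (- z\<^sup>2 / 2)"
      by (subst exp_add[symmetric]) simp
    then have "\<kappa> / sqrt (2 * pi) * exp (- (\<kappa> * z)\<^sup>2 / 2)
        \<le> \<kappa> / sqrt (2 * pi) * (exp (- (\<kappa>\<^sup>2 - 1) * x\<^sup>2 / 2) * exp (- z\<^sup>2 / 2))"
      using assms by (intro mult_left_mono) auto
    then show ?thesis
      by (simp add: C_def std_normal_density_def mult.assoc)
  qed
  have "ennreal (\<Phi> (- (\<kappa> * x)))
      = ennreal \<kappa> * (\<integral>\<^sup>+z. ennreal (std_normal_density (\<kappa> * z)) * indicator {..- (\<kappa> * x)} (\<kappa> * z) \<partial>lborel)"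
    unfolding ennreal_std_normal_cdf
    using assms by (subst nn_integral_real_affine[where c = \<kappa> and t = 0]) auto
  also have "\<dots> = (\<integral>\<^sup>+z. ennreal (\<kappa> * std_normal_density (\<kappa> * z)) * indicator {..- x} z \<partial>lborel)"
  proof (subst nn_integral_cmult[symmetric])
    have "\<kappa> * z \<le> - (\<kappa> * x) \<longleftrightarrow> z \<le> - x" for z
      using assms mult_le_cancel_left_pos[of \<kappa> z "- x"] by simp
    then show "(\<integral>\<^sup>+z. ennreal \<kappa> * (ennreal (std_normal_density (\<kappa> * z)) * indicator {..- (\<kappa> * x)} (\<kappa> * z)) \<partial>lborel)
        = (\<integral>\<^sup>+z. ennreal (\<kappa> * std_normal_density (\<kappa> * z)) * indicator {..- x} z \<partial>lborel)"
      using assms by (intro nn_integral_cong) (simp add: indicator_def ennreal_mult)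
  qed simp
  also have "\<dots> \<le> (\<integral>\<^sup>+z. ennreal (C * std_normal_density z) * indicator {..- x} z \<partial>lborel)"
    by (intro nn_integral_mono) (auto simp: indicator_def intro!: ennreal_leI le)
  also have "\<dots> = ennreal C * ennreal (\<Phi> (- x))"
    unfolding ennreal_std_normal_cdf
    using assms
    by (subst nn_integral_cmult[symmetric]) (auto simp: ennreal_mult mult.assoc)
  finally show ?thesis
    unfolding C_def[symmetric] using std_normal_cdf_nonneg by (simp flip: ennreal_mult)
qed

lemma (in prob_space) normal_tail_le:
  assumes Y: "distributed M lborel Y (normal_density 0 \<sigma>)" and "\<sigma> > 0"
  shows "prob {\<omega> \<in> space M. Y \<omega> > s} \<le> \<Phi> (- (s / \<sigma>))"
proof -
  have Z: "distributed M lborel (\<lambda>\<omega>. 0 + (- 1 / \<sigma>) * Y \<omega>) std_normal_density"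
    using normal_density_affine[OF Y \<open>\<sigma> > 0\<close>, of "- 1 / \<sigma>" 0] \<open>\<sigma> > 0\<close> by simp
  have "emeasure M {\<omega> \<in> space M. Y \<omega> > s}
      \<le> emeasure M ((\<lambda>\<omega>. 0 + (- 1 / \<sigma>) * Y \<omega>) -` {..- (s / \<sigma>)} \<inter> space M)"
  proof (rule emeasure_mono)
    show "{\<omega> \<in> space M. s < Y \<omega>} \<subseteq> (\<lambda>\<omega>. 0 + - 1 / \<sigma> * Y \<omega>) -` {..- (s / \<sigma>)} \<inter> space M"
      using \<open>\<sigma> > 0\<close> by (auto simp: divide_right_mono)
    show "(\<lambda>\<omega>. 0 + - 1 / \<sigma> * Y \<omega>) -` {..- (s / \<sigma>)} \<inter> space M \<in> sets M"
      using distributed_measurable[OF Z] by (rule measurable_sets) simp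
  qed
  also have "\<dots> = ennreal (\<Phi> (- (s / \<sigma>)))"
    unfolding ennreal_std_normal_cdf by (rule distributed_emeasure[OF Z]) simp
  finally show ?thesis
    by (simp add: emeasure_eq_measure std_normal_cdf_nonneg)
qed

text \<open>
  Bounding the variance instead of fixing it lets the point mass at \<open>0\<close> be treated like the
  nondegenerate normal laws.
\<close>
lemma (in prob_space) centred_normal_tail_le:
  assumes "normal_rv M Y" "expectation Y = 0" "expectation (\<lambda>\<omega>. (Y \<omega>)\<^sup>2) \<le> \<tau>\<^sup>2"
    and "\<tau> > 0" "s \<ge> 0"
  shows "prob {\<omega> \<in> space M. Y \<omega> > s} \<le> \<Phi> (- (s / \<tau>))"
  using assms(1) unfolding normal_rv_def
proof (elim disjE exE conjE)
  fix \<mu>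
  assume [measurable]: "Y \<in> borel_measurable M" and ae: "AE \<omega> in M. Y \<omega> = \<mu>"
  have "expectation Y = expectation (\<lambda>_. \<mu>)"
    using ae by (intro integral_cong_AE) auto
  then have "\<mu> = 0"
    using assms(2) by (simp add: prob_space)
  then have "AE \<omega> in M. \<not> Y \<omega> > s"
    using ae assms(5) by auto
  then have "prob {\<omega> \<in> space M. Y \<omega> > s} = 0"
    by (subst prob_eq_0) auto
  then show ?thesis
    by (simp add: std_normal_cdf_nonneg)
next
  fix \<mu> \<sigma> :: real
  assume "\<sigma> > 0" and D: "distributed M lborel Y (normal_density \<mu> \<sigma>)"
  have \<mu>: "\<mu> = 0"
    using normal_distributed_expectation[OF \<open>\<sigma> > 0\<close> D] assms(2) by simp
  have "\<sigma>\<^sup>2 \<le> \<tau>\<^sup>2"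
    using normal_distributed_variance[OF \<open>\<sigma> > 0\<close> D] assms(2,3) by simp
  then have "\<sigma> \<le> \<tau>"
    using \<open>\<tau> > 0\<close> by (simp add: power2_le_imp_le[of \<sigma> \<tau>])
  have "prob {\<omega> \<in> space M. Y \<omega> > s} \<le> \<Phi> (- (s / \<sigma>))"
    using D \<open>\<sigma> > 0\<close> unfolding \<mu> by (rule normal_tail_le)
  also have "\<dots> \<le> \<Phi> (- (s / \<tau>))"
    using \<open>\<sigma> \<le> \<tau>\<close> \<open>\<sigma> > 0\<close> \<open>s \<ge> 0\<close> by (intro std_normal_cdf_mono) (simp add: divide_left_mono)
  finally show ?thesis .
qed

section \<open>Equicorrelated standard normal variables\<close>

lemma (in prob_space) std_normal_moments:
  assumes D: "distributed M lborel Y std_normal_density"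
  shows "integrable M Y" "expectation Y = 0"
    "integrable M (\<lambda>\<omega>. (Y \<omega>)\<^sup>2)" "expectation (\<lambda>\<omega>. (Y \<omega>)\<^sup>2) = 1"
proof -
  show "integrable M Y"
    using distributed_integrable[OF D, of "\<lambda>x. x"] integrable_std_normal_moment[of 1] by simp
  show E: "expectation Y = 0"
    using D by (rule standard_normal_distributed_expectation)
  show "integrable M (\<lambda>\<omega>. (Y \<omega>)\<^sup>2)"
    using distributed_integrable[OF D, of "\<lambda>x. x\<^sup>2"] integrable_std_normal_moment[of 2] by simp
  show "expectation (\<lambda>\<omega>. (Y \<omega>)\<^sup>2) = 1"
    using standard_normal_distributed_variance[OF D] E by simp
qed

lemma (in prob_space) expectation_mult_std_normal:
  assumes "distributed M lborel Y std_normal_density" "distributed M lborel Z std_normal_density"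
  shows "expectation (\<lambda>\<omega>. Y \<omega> * Z \<omega>) = correlation M Y Z"
  using std_normal_moments[OF assms(1)] std_normal_moments[OF assms(2)]
  by (simp add: correlation_def covariance_def flip: power2_eq_square)

lemma integrable_mult_of_square:
  fixes f g :: "'a \<Rightarrow> real"
  assumes "integrable M f" "integrable M g"
    and "integrable M (\<lambda>x. (f x)\<^sup>2)" "integrable M (\<lambda>x. (g x)\<^sup>2)"
  shows "integrable M (\<lambda>x. f x * g x)"
proof (rule Bochner_Integration.integrable_bound)
  show "integrable M (\<lambda>x. (f x)\<^sup>2 + (g x)\<^sup>2)"
    using assms by simp
  show "(\<lambda>x. f x * g x) \<in> borel_measurable M"
    using assms(1,2) by measurable
  have "\<bar>u * v\<bar> \<le> u\<^sup>2 + v\<^sup>2" for u v :: real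
    using sum_squares_bound[of u v] sum_squares_bound[of u "- v"] by (simp add: abs_le_iff)
  then show "AE x in M. norm (f x * g x) \<le> norm ((f x)\<^sup>2 + (g x)\<^sup>2)"
    by simp
qed

lemma (in prob_space) expectation_linear_combination:
  assumes "\<And>i. i \<in> I \<Longrightarrow> distributed M lborel (X i) std_normal_density"
  shows "expectation (\<lambda>\<omega>. \<Sum>i\<in>I. a i * X i \<omega>) = 0"
  using std_normal_moments[OF assms]
  by (subst Bochner_Integration.integral_sum) auto

text \<open>
  The covariance matrix is \<open>1 - \<rho>\<close> times the identity plus \<open>\<rho>\<close> times the all-ones matrix. The
  second part acts on \<open>a\<close> only through the sum of its entries, so it drops out for the residuals
  from the sample mean, whose coefficients sum to \<open>0\<close>.
\<close>
lemma (in prob_space) equicorrelated_second_moment: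
  assumes "finite I"
    and D: "\<And>i. i \<in> I \<Longrightarrow> distributed M lborel (X i) std_normal_density"
    and corr: "\<And>i j. i \<in> I \<Longrightarrow> j \<in> I \<Longrightarrow> i \<noteq> j \<Longrightarrow> correlation M (X i) (X j) = \<rho>"
  shows "expectation (\<lambda>\<omega>. (\<Sum>i\<in>I. a i * X i \<omega>)\<^sup>2) = (1 - \<rho>) * (\<Sum>i\<in>I. (a i)\<^sup>2) + \<rho> * (\<Sum>i\<in>I. a i)\<^sup>2"
proof -
  have int: "integrable M (\<lambda>\<omega>. X i \<omega> * X j \<omega>)" if "i \<in> I" "j \<in> I" for i j
    using std_normal_moments[OF D] that by (intro integrable_mult_of_square) auto
  have E: "expectation (\<lambda>\<omega>. X i \<omega> * X j \<omega>) = (if i = j then 1 - \<rho> else 0) + \<rho>"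
    if "i \<in> I" "j \<in> I" for i j
  proof (cases "i = j")
    case True
    then show ?thesis
      using std_normal_moments(4)[OF D[OF that(1)]] by (simp add: power2_eq_square)
  next
    case False
    then show ?thesis
      using expectation_mult_std_normal[OF D[OF that(1)] D[OF that(2)]] corr[OF that] by simp
  qed
  have "expectation (\<lambda>\<omega>. (\<Sum>i\<in>I. a i * X i \<omega>)\<^sup>2)
      = expectation (\<lambda>\<omega>. \<Sum>i\<in>I. \<Sum>j\<in>I. a i * a j * (X i \<omega> * X j \<omega>))"
    by (simp add: power2_eq_square sum_product mult_ac)
  also have "\<dots> = (\<Sum>i\<in>I. \<Sum>j\<in>I. a i * a j * expectation (\<lambda>\<omega>. X i \<omega> * X j \<omega>))"
    using int by (simp add: Bochner_Integration.integral_sum)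
  also have "\<dots> = (\<Sum>i\<in>I. \<Sum>j\<in>I. (if i = j then (1 - \<rho>) * (a i)\<^sup>2 else 0) + \<rho> * (a i * a j))"
    by (intro sum.cong refl) (auto simp: E power2_eq_square algebra_simps)
  also have "\<dots> = (1 - \<rho>) * (\<Sum>i\<in>I. (a i)\<^sup>2) + \<rho> * (\<Sum>i\<in>I. a i)\<^sup>2"
    using \<open>finite I\<close>
    by (simp add: sum.distrib power2_eq_square sum_product flip: sum_distrib_left)
  finally show ?thesis .
qed

section \<open>Bounds on the family wise error rate\<close>

lemma (in prob_space) FWER_union_bound:
  assumes D: "\<And>i. i \<in> {1..n} \<Longrightarrow> distributed M lborel (X i) std_normal_density"
  shows "FWER M n X c \<le> real n * \<Phi> (- c)"
proof -
  have [measurable]: "X i \<in> borel_measurable M" if "i \<in> {1..n}" for i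
    using distributed_measurable[OF D[OF that]] by simp
  have "FWER M n X c = prob (\<Union>i\<in>{1..n}. {\<omega> \<in> space M. X i \<omega> > c})"
    unfolding FWER_def by (rule arg_cong[where f = prob]) auto
  also have "\<dots> \<le> (\<Sum>i\<in>{1..n}. prob {\<omega> \<in> space M. X i \<omega> > c})"
    by (rule finite_measure_subadditive_finite) auto
  also have "\<dots> \<le> (\<Sum>i\<in>{1..n}. \<Phi> (- c))"
    using normal_tail_le[OF D, of _ c] by (intro sum_mono) simp
  finally show ?thesis by simp
qed

text \<open>
  The level \<open>c = t + s\<close> is split between the sample mean, which has to exceed \<open>t\<close>, and a
  residual, which has to exceed \<open>s\<close>.
\<close>
lemma (in prob_space) FWER_mean_residual_bound:
  assumes "n \<ge> 1" and \<rho>: "0 \<le> \<rho>" "\<rho> \<le> 1"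
    and J: "jointly_normal M {1..n} X"
    and D: "\<And>i. i \<in> {1..n} \<Longrightarrow> distributed M lborel (X i) std_normal_density"
    and corr: "\<And>i j. i \<in> {1..n} \<Longrightarrow> j \<in> {1..n} \<Longrightarrow> i \<noteq> j \<Longrightarrow> correlation M (X i) (X j) = \<rho>"
    and "\<tau> > 0" "1 - \<rho> \<le> \<tau>\<^sup>2" "t \<ge> 0" "s \<ge> 0"
  shows "FWER M n X (t + s) \<le> \<Phi> (- t) + real n * \<Phi> (- (s / \<tau>))"
proof -
  let ?I = "{1..n}"
  define A where "A \<omega> = (\<Sum>j\<in>?I. 1 / real n * X j \<omega>)" for \<omega>
  define R where "R i \<omega> = (\<Sum>j\<in>?I. ((if j = i then 1 else 0) - 1 / real n) * X j \<omega>)" for i \<omega>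
  have [measurable]: "X i \<in> borel_measurable M" if "i \<in> ?I" for i
    using distributed_measurable[OF D[OF that]] by simp
  have [measurable]: "A \<in> borel_measurable M" "R i \<in> borel_measurable M" for i
    unfolding A_def R_def by measurable
  have decomp: "X i \<omega> = A \<omega> + R i \<omega>" if "i \<in> ?I" for i \<omega>
  proof -
    have "A \<omega> + R i \<omega> = (\<Sum>j\<in>?I. if j = i then X j \<omega> else 0)"
      unfolding A_def R_def sum.distrib[symmetric]
      by (intro sum.cong refl) (auto simp: algebra_simps)
    then show ?thesis using that by simp
  qed
  have "prob {\<omega> \<in> space M. A \<omega> > t} \<le> \<Phi> (- (t / 1))"
  proof (rule centred_normal_tail_le)
    show "normal_rv M A"
      unfolding A_def
      using J[unfolded jointly_normal_def, THEN spec, of "\<lambda>_. 1 / real n"] .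
    show "expectation A = 0"
      unfolding A_def by (rule expectation_linear_combination[OF D])
    have "expectation (\<lambda>\<omega>. (A \<omega>)\<^sup>2) = (1 - \<rho>) * (1 / real n) + \<rho>"
      unfolding A_def
      using \<open>n \<ge> 1\<close> by (subst equicorrelated_second_moment[OF _ D corr]) (auto simp: power2_eq_square)
    also have "\<dots> \<le> (1 - \<rho>) * 1 + \<rho>"
      using \<rho> \<open>n \<ge> 1\<close> by (intro add_right_mono mult_left_mono) auto
    finally show "expectation (\<lambda>\<omega>. (A \<omega>)\<^sup>2) \<le> 1\<^sup>2" by simp
  qed (use assms in auto)
  moreover have "prob {\<omega> \<in> space M. R i \<omega> > s} \<le> \<Phi> (- (s / \<tau>))" if i: "i \<in> ?I" for i
  proof (rule centred_normal_tail_le)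
    show "normal_rv M (R i)"
      unfolding R_def
      using J[unfolded jointly_normal_def, THEN spec,
        of "\<lambda>j. (if j = i then 1 else 0) - 1 / real n"] .
    show "expectation (R i) = 0"
      unfolding R_def by (rule expectation_linear_combination[OF D])
    let ?a = "\<lambda>j. (if j = i then 1 else 0) - 1 / real n"
    have sum: "(\<Sum>j\<in>?I. ?a j) = 0"
      using i by (simp add: sum_subtractf)
    have "(\<Sum>j\<in>?I. (?a j)\<^sup>2) = (\<Sum>j\<in>?I. (if j = i then 1 - 2 / real n else 0) + 1 / (real n)\<^sup>2)"
      by (intro sum.cong refl) (auto simp: power2_eq_square algebra_simps)
    also have "\<dots> = 1 - 1 / real n"
      using i by (simp add: sum.distrib power2_eq_square)
    finally have squares: "(\<Sum>j\<in>?I. (?a j)\<^sup>2) = 1 - 1 / real n" .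
    have "expectation (\<lambda>\<omega>. (R i \<omega>)\<^sup>2) = (1 - \<rho>) * (1 - 1 / real n)"
      unfolding R_def
      by (subst equicorrelated_second_moment[OF _ D corr]) (simp_all add: sum squares del: One_nat_def)
    also have "\<dots> \<le> (1 - \<rho>) * 1"
      using \<rho> by (intro mult_left_mono) auto
    finally show "expectation (\<lambda>\<omega>. (R i \<omega>)\<^sup>2) \<le> \<tau>\<^sup>2"
      using assms by simp
  qed (use assms in auto)
  moreover have "FWER M n X (t + s)
      \<le> prob ({\<omega> \<in> space M. A \<omega> > t} \<union> (\<Union>i\<in>?I. {\<omega> \<in> space M. R i \<omega> > s}))"
    unfolding FWER_def
  proof (rule finite_measure_mono)
    show "{\<omega> \<in> space M. \<exists>i\<in>?I. t + s < X i \<omega>}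
        \<subseteq> {\<omega> \<in> space M. t < A \<omega>} \<union> (\<Union>i\<in>?I. {\<omega> \<in> space M. s < R i \<omega>})"
    proof
      fix \<omega>
      assume "\<omega> \<in> {\<omega> \<in> space M. \<exists>i\<in>?I. t + s < X i \<omega>}"
      then obtain i where "\<omega> \<in> space M" "i \<in> ?I" "t + s < A \<omega> + R i \<omega>"
        by (auto simp: decomp)
      moreover from this have "t < A \<omega> \<or> s < R i \<omega>"
        by linarith
      ultimately show "\<omega> \<in> {\<omega> \<in> space M. t < A \<omega>} \<union> (\<Union>i\<in>?I. {\<omega> \<in> space M. s < R i \<omega>})"
        by blast
    qed
  qed auto
  moreover have "\<dots> \<le> prob {\<omega> \<in> space M. A \<omega> > t} + prob (\<Union>i\<in>?I. {\<omega> \<in> space M. R i \<omega> > s})"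
    by (rule measure_Un_le) auto
  moreover have "prob (\<Union>i\<in>?I. {\<omega> \<in> space M. R i \<omega> > s})
      \<le> (\<Sum>i\<in>?I. prob {\<omega> \<in> space M. R i \<omega> > s})"
    by (rule finite_measure_subadditive_finite) auto
  moreover have "(\<Sum>i\<in>?I. prob {\<omega> \<in> space M. R i \<omega> > s}) \<le> (\<Sum>i\<in>?I. \<Phi> (- (s / \<tau>)))"
    using calculation(2) by (rule sum_mono)
  ultimately show ?thesis by simp
qed

lemma bonferroni_threshold_at_top:
  assumes "\<And>n. n \<ge> 1 \<Longrightarrow> \<Phi> (- c n) = \<alpha> / real n"
  shows "filterlim c at_top sequentially"
  unfolding filterlim_at_top
proof
  fix K :: real
  have "(\<lambda>n. \<alpha> / real n) \<longlonglongrightarrow> 0"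
    by (rule lim_const_over_n)
  then have "eventually (\<lambda>n. \<alpha> / real n < \<Phi> (- K)) sequentially"
    using std_normal_cdf_pos by (rule order_tendstoD)
  then show "eventually (\<lambda>n. K \<le> c n) sequentially"
    using eventually_ge_at_top[of "1 :: nat"]
  proof eventually_elim
    case (elim n)
    then have "\<Phi> (- c n) < \<Phi> (- K)"
      using assms by simp
    then show ?case
      using std_normal_cdf_mono[of "- K" "- c n"] by linarith
  qed
qed

theorem mainTheorem3:
  fixes \<alpha> \<rho> :: real
    and c :: "nat \<Rightarrow> real"
    and M :: "nat \<Rightarrow> 'a measure"
    and X :: "nat \<Rightarrow> nat \<Rightarrow> 'a \<Rightarrow> real"
  assumes "\<alpha> \<in> {0<..<1}"
    and "\<rho> \<in> {0..1}"
    and "\<And>n. n \<ge> 1 \<Longrightarrow> \<Phi> (- c n) = \<alpha> / real n"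
    and "\<And>n. n \<ge> 1 \<Longrightarrow> prob_space (M n)"
    and "\<And>n. n \<ge> 1 \<Longrightarrow> jointly_normal (M n) {1..n} (X n)"
    and "\<And>n i. n \<ge> 1 \<Longrightarrow> i \<in> {1..n} \<Longrightarrow>
           distributed (M n) lborel (X n i) std_normal_density"
    and "\<And>n i j. n \<ge> 1 \<Longrightarrow> i \<in> {1..n} \<Longrightarrow> j \<in> {1..n} \<Longrightarrow> i \<noteq> j \<Longrightarrow>
           correlation (M n) (X n i) (X n j) = \<rho>"
  shows "limsup (\<lambda>n. ereal (FWER (M n) n (X n) (c n))) \<le> ereal (\<alpha> * (1 - \<rho>))"
proof (cases "\<rho> = 0")
  case True
  have le: "FWER (M n) n (X n) (c n) \<le> \<alpha>" if "n \<ge> 1" for n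
    using prob_space.FWER_union_bound[OF assms(4) assms(6), where n = n and c = "c n"] assms(3)[of n] that
    by simp
  have "eventually (\<lambda>n. ereal (FWER (M n) n (X n) (c n)) \<le> ereal \<alpha>) sequentially"
    using eventually_ge_at_top[of "1 :: nat"] by eventually_elim (simp add: le)
  then have "limsup (\<lambda>n. ereal (FWER (M n) n (X n) (c n))) \<le> ereal \<alpha>"
    by (rule Limsup_bounded)
  then show ?thesis
    using True by simp
next
  case False
  \<comment> \<open>\<open>\<tau>\<close> exceeds the standard deviation \<open>sqrt (1 - \<rho>)\<close> of the residuals by so much that room
      remains for a positive share \<open>\<delta>\<close> of the level, and it stays positive for \<open>\<rho> = 1\<close>.\<close>
  define \<tau> \<delta> \<kappa> where "\<tau> = 1 - \<rho> / 2" and "\<delta> = \<rho> / 4" and "\<kappa> = (1 - \<delta>) / \<tau>"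
  have \<rho>: "0 < \<rho>" "\<rho> \<le> 1"
    using assms(2) False by auto
  then have params: "\<tau> > 0" "\<delta> > 0" "\<delta> < 1" "\<kappa> > 1"
    by (auto simp: \<tau>_def \<delta>_def \<kappa>_def field_simps)
  have \<tau>: "1 - \<rho> \<le> \<tau>\<^sup>2"
    by (simp add: \<tau>_def power2_eq_square algebra_simps)
  define B where "B x = \<Phi> (- (\<delta> * x)) + \<alpha> * (\<kappa> * exp (- (\<kappa>\<^sup>2 - 1) * x\<^sup>2 / 2))" for x
  have c_top: "filterlim c at_top sequentially"
    using assms(3) by (rule bonferroni_threshold_at_top)
  have bound: "FWER (M n) n (X n) (c n) \<le> B (c n)" if "n \<ge> 1" "c n \<ge> 0" for n
  proof -
    have "FWER (M n) n (X n) (\<delta> * c n + (1 - \<delta>) * c n)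
        \<le> \<Phi> (- (\<delta> * c n)) + real n * \<Phi> (- ((1 - \<delta>) * c n / \<tau>))"
      using that params \<tau> \<rho>
      by (intro prob_space.FWER_mean_residual_bound[OF assms(4) _ _ _ assms(5-7)]) auto
    also have "\<delta> * c n + (1 - \<delta>) * c n = c n"
      by (simp add: algebra_simps)
    also have "(1 - \<delta>) * c n / \<tau> = \<kappa> * c n"
      by (simp add: \<kappa>_def)
    also have "real n * \<Phi> (- (\<kappa> * c n))
        \<le> real n * (\<kappa> * exp (- (\<kappa>\<^sup>2 - 1) * (c n)\<^sup>2 / 2) * \<Phi> (- c n))"
      using params that by (intro mult_left_mono std_normal_cdf_scale_le) auto
    also have "\<dots> = \<alpha> * (\<kappa> * exp (- (\<kappa>\<^sup>2 - 1) * (c n)\<^sup>2 / 2))"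
      using assms(3) that by simp
    finally show ?thesis
      by (simp add: B_def)
  qed
  have "(B \<longlongrightarrow> 0 + \<alpha> * (\<kappa> * 0)) at_top"
    unfolding B_def
  proof (intro tendsto_intros)
    have "filterlim (\<lambda>x. - (\<delta> * x)) at_bot at_top"
      using params by real_asymp
    then show "((\<lambda>x. \<Phi> (- (\<delta> * x))) \<longlongrightarrow> 0) at_top"
      by (rule filterlim_compose[OF std_normal_cdf_at_bot])
    have "\<kappa>\<^sup>2 - 1 > 0"
      using params by (simp add: one_less_power)
    then show "((\<lambda>x. exp (- (\<kappa>\<^sup>2 - 1) * x\<^sup>2 / 2)) \<longlongrightarrow> 0) at_top"
      by real_asymp
  qed
  then have "(\<lambda>n. B (c n)) \<longlonglongrightarrow> 0"
    using filterlim_compose[OF _ c_top] by simp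
  then have lim: "limsup (\<lambda>n. ereal (B (c n))) = 0"
    by (intro lim_imp_Limsup) (auto simp: zero_ereal_def)
  have "eventually (\<lambda>n. c n \<ge> 0) sequentially"
    using c_top by (simp add: filterlim_at_top)
  then have "eventually (\<lambda>n. ereal (FWER (M n) n (X n) (c n)) \<le> ereal (B (c n))) sequentially"
    using eventually_ge_at_top[of "1 :: nat"] by eventually_elim (simp add: bound)
  then have "limsup (\<lambda>n. ereal (FWER (M n) n (X n) (c n))) \<le> limsup (\<lambda>n. ereal (B (c n)))"
    by (rule Limsup_mono)
  also have "\<dots> \<le> ereal (\<alpha> * (1 - \<rho>))"
    unfolding lim using assms(1) \<rho> by simp
  finally show ?thesis .
qed

end
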